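(* Let $k\geq 3$ and let $\sigma$ be the classical pattern $2\mbox{-}3\mbox{-}\cdots\mbox{-}k\mbox{-}1$ (the permutation $23\cdots k1$). For $n\ge0$ let $ud(n)$, $dd(n)$, $uu(n)$, $du(n)$ be, respectively, the numbers of up-down, down-down, up-up and down-up permutations of length $n$ avoiding both $1\mbox{-}3\mbox{-}2$ and $\sigma$, with generating functions $UD(x)=\sum_n ud(n)x^n$, $DD(x)=\sum_n dd(n)x^n$, $UU(x)=\sum_n uu(n)x^n$, $DU(x)=\sum_n du(n)x^n$. Writing $U_r$ for $U_r\!\left(\frac1{2x}\right)$, (1) $UD(x)=\dfrac{xU_{k-4}}{U_{k-2}}$; (2) $DD(x)=\dfrac{x^{k-2}+U_{k-4}}{U_{k-2}}$; (3) $UU(x)=\dfrac{U_{k-3}^2}{U_{k-2}^2}$; (4) $DU(x)=\dfrac{x}{U_{k-2}^2}\Bigl(x^{k-3}\bigl(U_{k-3}+xU_{k-2}\bigr)+2U_{k-3}^2+U_{k-4}^2-2\Bigr)$.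
   Context: A permutation of length $n$ is a word $\pi_1\cdots\pi_n$ containing each of $1,\dots,n$ exactly once. A classical pattern $\tau$ (written with dashes between letters) occurs in $\pi$ if some subsequence $\pi_{i_1}\cdots\pi_{i_m}$ ($i_1<\dots<i_m$) is order-isomorphic to $\tau$; otherwise $\pi$ avoids $\tau$. $1\mbox{-}3\mbox{-}2$ is the classical pattern $132$. For $n\ge2$: up-down permutations satisfy $\pi_1<\pi_2>\pi_3<\cdots$ and have odd length; up-up ones satisfy $\pi_1<\pi_2>\pi_3<\cdots$ and have even length; down-up ones satisfy $\pi_1>\pi_2<\pi_3>\cdots$ and have odd length; down-down ones satisfy $\pi_1>\pi_2<\pi_3>\cdots$ and have even length. For $n=0,1$ these classes are empty. $U_r$ is the Chebyshev polynomial of the second kind, $U_r(\cos\theta)=\sin((r+1)\theta)/\sin\theta$; in particular $U_{-1}=0$, $U_0=1$, $U_1(t)=2t$, $U_r(t)=2tU_{r-1}(t)-U_{r-2}(t)$. *)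

theory Defs
  imports
    Complex_Main
    "HOL-Library.Sublist"
    "HOL-Combinatorics.Multiset_Permutations"
    "HOL-Computational_Algebra.Formal_Laurent_Series"
begin

definition order_isomorphic :: "nat list \<Rightarrow> nat list \<Rightarrow> bool" where
  "order_isomorphic xs ys \<longleftrightarrow> length xs = length ys \<and>
     (\<forall>i<length xs. \<forall>j<length xs. xs ! i < xs ! j \<longleftrightarrow> ys ! i < ys ! j)"

definition avoids :: "nat list \<Rightarrow> nat list \<Rightarrow> bool" where
  "avoids \<pi> \<tau> \<longleftrightarrow> \<not> (\<exists>xs. subseq xs \<pi> \<and> order_isomorphic xs \<tau>)"

definition pattern_sigma :: "nat \<Rightarrow> nat list" where
  "pattern_sigma k = [2..<Suc k] @ [1]"

text \<open>List positions are counted from 0, so the first step of the word is the one at the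
  even position 0.\<close>

definition alternating_up :: "nat list \<Rightarrow> bool" where
  "alternating_up \<pi> \<longleftrightarrow> (\<forall>i. Suc i < length \<pi> \<longrightarrow>
     (if even i then \<pi> ! i < \<pi> ! Suc i else \<pi> ! i > \<pi> ! Suc i))"

definition alternating_down :: "nat list \<Rightarrow> bool" where
  "alternating_down \<pi> \<longleftrightarrow> (\<forall>i. Suc i < length \<pi> \<longrightarrow>
     (if even i then \<pi> ! i > \<pi> ! Suc i else \<pi> ! i < \<pi> ! Suc i))"

definition up_down :: "nat \<Rightarrow> nat list set" where
  "up_down n = {\<pi> \<in> permutations_of_set {1..n}. n \<ge> 2 \<and> odd n \<and> alternating_up \<pi>}"

definition up_up :: "nat \<Rightarrow> nat list set" where
  "up_up n = {\<pi> \<in> permutations_of_set {1..n}. n \<ge> 2 \<and> even n \<and> alternating_up \<pi>}"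

definition down_up :: "nat \<Rightarrow> nat list set" where
  "down_up n = {\<pi> \<in> permutations_of_set {1..n}. n \<ge> 2 \<and> odd n \<and> alternating_down \<pi>}"

definition down_down :: "nat \<Rightarrow> nat list set" where
  "down_down n = {\<pi> \<in> permutations_of_set {1..n}. n \<ge> 2 \<and> even n \<and> alternating_down \<pi>}"

definition ud :: "nat \<Rightarrow> nat \<Rightarrow> nat" where
  "ud k n = card {\<pi> \<in> up_down n. avoids \<pi> [1, 3, 2] \<and> avoids \<pi> (pattern_sigma k)}"

definition dd :: "nat \<Rightarrow> nat \<Rightarrow> nat" where
  "dd k n = card {\<pi> \<in> down_down n. avoids \<pi> [1, 3, 2] \<and> avoids \<pi> (pattern_sigma k)}"

definition uu :: "nat \<Rightarrow> nat \<Rightarrow> nat" where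
  "uu k n = card {\<pi> \<in> up_up n. avoids \<pi> [1, 3, 2] \<and> avoids \<pi> (pattern_sigma k)}"

definition du :: "nat \<Rightarrow> nat \<Rightarrow> nat" where
  "du k n = card {\<pi> \<in> down_up n. avoids \<pi> [1, 3, 2] \<and> avoids \<pi> (pattern_sigma k)}"

definition gen_fun :: "(nat \<Rightarrow> nat) \<Rightarrow> real fps" where
  "gen_fun a = Abs_fps (\<lambda>n. of_nat (a n))"

text \<open>Chebyshev polynomials of the second kind, indexed by integers so that the index \<open>-1\<close> is
  available; for \<open>r < -1\<close> the value \<open>0\<close> is arbitrary.\<close>

function cheb_U :: "int \<Rightarrow> 'a::comm_ring_1 poly" where
  "cheb_U r = (if r \<le> -1 then 0 else if r = 0 then 1
               else [:0, 2:] * cheb_U (r - 1) - cheb_U (r - 2))"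
  by auto
termination by (relation "measure (\<lambda>r. nat (r + 1))") auto

declare cheb_U.simps [simp del]

lemma cheb_U_cos:
  fixes \<theta> :: real
  assumes "r \<ge> -1"
  shows "poly (cheb_U r) (cos \<theta>) * sin \<theta> = sin ((of_int r + 1) * \<theta>)"
  using assms
proof (induction r rule: cheb_U.induct)
  case (1 r)
  consider "r = -1" | "r = 0" | "r \<ge> 1"
    using "1.prems" by linarith
  then show ?case
  proof cases
    case 3
    have IH1: "poly (cheb_U (r - 1)) (cos \<theta>) * sin \<theta> = sin (of_int r * \<theta>)"
      and IH2: "poly (cheb_U (r - 2)) (cos \<theta>) * sin \<theta> = sin ((of_int r - 1) * \<theta>)"
      using "1.IH" 3 by auto
    have "poly (cheb_U r) (cos \<theta>) * sin \<theta> =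
        2 * cos \<theta> * (poly (cheb_U (r - 1)) (cos \<theta>) * sin \<theta>)
        - poly (cheb_U (r - 2)) (cos \<theta>) * sin \<theta>"
      using 3 by (subst cheb_U.simps) (simp add: algebra_simps)
    also have "\<dots> = sin ((of_int r + 1) * \<theta>)"
      unfolding IH1 IH2 by (simp add: ring_distribs sin_add sin_diff)
    finally show ?thesis .
  qed (simp_all add: cheb_U.simps)
qed

text \<open>\<open>U\<^sub>r(1/(2x))\<close> is a polynomial in \<open>x\<^sup>-\<^sup>1\<close>, hence a formal Laurent series in \<open>x\<close>. Formal
  Laurent series over a field form a field, in which the quotients of the theorem are taken.\<close>

definition cheb_U_at :: "int \<Rightarrow> real fls" where
  "cheb_U_at r = poly (cheb_U r) (1 / (2 * fls_X))"

text \<open>The denominators of the theorem are nonzero.\<close>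

lemma cheb_U_at_nonzero:
  assumes "r \<ge> 0"
  shows "cheb_U_at r \<noteq> 0"
proof -
  have rec: "cheb_U_at r = fls_shift 1 (cheb_U_at (r - 1)) - cheb_U_at (r - 2)" if "r \<ge> 1" for r
    using that unfolding cheb_U_at_def
    by (subst cheb_U.simps) (simp add: field_simps)
  have lead: "fls_nth (cheb_U_at r) (-r) = 1 \<and> (\<forall>m < -r. fls_nth (cheb_U_at r) m = 0)"
    if "r \<ge> 0" for r
    using that
  proof (induction "nat r" arbitrary: r rule: less_induct)
    case less
    consider "r = 0" | "r = 1" | "r \<ge> 2"
      using less.prems by linarith
    then show ?case
    proof cases
      case 1
      then show ?thesis by (simp add: cheb_U_at_def cheb_U.simps)
    next
      case 2
      then show ?thesis
        by (subst (1 2) rec) (auto simp: cheb_U_at_def cheb_U.simps)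
    next
      case 3
      have "r \<ge> 1" using 3 by simp
      moreover have "fls_nth (cheb_U_at (r - 1)) (-r + 1) = 1"
        "\<forall>m < -r + 1. fls_nth (cheb_U_at (r - 1)) m = 0"
        using less.hyps [of "r - 1"] 3 by (auto simp: algebra_simps)
      moreover have "\<forall>m < 2 - r. fls_nth (cheb_U_at (r - 2)) m = 0"
        using less.hyps [of "r - 2"] 3 by (auto simp: algebra_simps)
      ultimately show ?thesis
        by (simp add: rec)
    qed
  qed
  show ?thesis using lead [OF assms] by auto
qed

end

theory Submission
  imports Defs
begin

text \<open>A permutation avoids \<open>132\<close> iff it has the form \<open>L n R\<close> with \<open>n\<close> its maximum, \<open>L\<close> and \<open>R\<close> avoiding
  \<open>132\<close> and every letter of \<open>L\<close> above every letter of \<open>R\<close>. If \<open>R\<close> is nonempty, then \<open>L n R\<close> avoids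
  \<open>23\<cdots>k1\<close> iff \<open>R\<close> does and \<open>L\<close> has no increasing subsequence of length \<open>k - 2\<close>; the same
  decomposition lowers the bound on increasing subsequences of \<open>L\<close> by one. Write \<open>A\<^sub>m\<close>
  and \<open>D\<^sub>m\<close> for the generating functions of the odd-length permutations starting with an ascent
  (including length 1) and of the even-length ones starting with a descent (including length 0) whose
  increasing subsequences have length at most \<open>m\<close>. Then \<open>A\<^sub>m\<^sub>+\<^sub>1 = x (A\<^sub>m A\<^sub>m\<^sub>+\<^sub>1 + 1)\<close> and
  \<open>D\<^sub>m\<^sub>+\<^sub>1 = 1 + x D\<^sub>m A\<^sub>m\<^sub>+\<^sub>1\<close>, so that \<open>A\<^sub>m = U\<^sub>m\<^sub>-\<^sub>1 / U\<^sub>m\<close> and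
  \<open>x D\<^sub>m U\<^sub>m = x\<^sup>m\<^sup>+\<^sup>1 + U\<^sub>m\<^sub>-\<^sub>1\<close>. The four series of the theorem are rational functions of
  \<open>A\<^sub>k\<^sub>-\<^sub>3\<close>, \<open>D\<^sub>k\<^sub>-\<^sub>3\<close> and \<open>x\<close>, and the last one is brought to the stated form by
  \<open>U\<^sub>r\<^sup>2 - U\<^sub>r\<^sub>+\<^sub>1 U\<^sub>r\<^sub>-\<^sub>1 = 1\<close>.\<close>

subsection \<open>Alternation and pattern avoidance as predicates on words\<close>

text \<open>The Boolean is the direction of the first step, \<open>True\<close> for an ascent. With
  it as a parameter, the direction of a factor of a word can be computed from the parity of the
  position where the factor starts.\<close>

definition alternating :: "bool \<Rightarrow> nat list \<Rightarrow> bool" where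
  "alternating b \<pi> \<longleftrightarrow> (\<forall>i. Suc i < length \<pi> \<longrightarrow>
     (if even i = b then \<pi> ! i < \<pi> ! Suc i else \<pi> ! i > \<pi> ! Suc i))"

lemma alternating_Nil [simp]: "alternating b []"
  by (simp add: alternating_def)

abbreviation "odd_up \<pi> \<equiv> alternating True \<pi> \<and> odd (length \<pi>)"
abbreviation "even_up \<pi> \<equiv> alternating True \<pi> \<and> even (length \<pi>)"
abbreviation "odd_down \<pi> \<equiv> alternating False \<pi> \<and> odd (length \<pi>)"
abbreviation "even_down \<pi> \<equiv> alternating False \<pi> \<and> even (length \<pi>)"

text \<open>Avoidance of 12...(m+1), phrased by lengths so that lowering the bound becomes
  arithmetic.\<close>

definition inc_bound :: "nat \<Rightarrow> nat list \<Rightarrow> bool" where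
  "inc_bound m \<pi> \<longleftrightarrow> (\<forall>xs. subseq xs \<pi> \<longrightarrow> sorted_wrt (<) xs \<longrightarrow> length xs \<le> m)"

text \<open>Avoidance of 23...(m+2)1, with \<open>y\<close> in the role of the final 1.\<close>

definition inc_over_bound :: "nat \<Rightarrow> nat list \<Rightarrow> bool" where
  "inc_over_bound m \<pi> \<longleftrightarrow> (\<forall>xs y. subseq (xs @ [y]) \<pi> \<longrightarrow> sorted_wrt (<) xs \<longrightarrow>
     (\<forall>x\<in>set xs. y < x) \<longrightarrow> length xs \<le> m)"

text \<open>The left factor at the maximum is counted as a permutation of an initial segment, but it
  occurs with all its letters raised by a constant. A predicate on it must survive that
  shift.\<close>

definition shift_invariant :: "(nat list \<Rightarrow> bool) \<Rightarrow> bool" where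
  "shift_invariant P \<longleftrightarrow> (\<forall>c \<pi>. P (map ((+) c) \<pi>) \<longleftrightarrow> P \<pi>)"

section \<open>Occurrences of the two patterns as explicit subsequences\<close>

lemma avoids_132_iff:
  "avoids \<pi> [1, 3, 2] \<longleftrightarrow> \<not> (\<exists>a b c. subseq [a, b, c] \<pi> \<and> a < c \<and> c < b)"
proof -
  have iff: "order_isomorphic xs [1, 3, 2] \<longleftrightarrow> (\<exists>a b c. xs = [a, b, c] \<and> a < c \<and> c < b)" for xs
  proof
    assume *: "order_isomorphic xs [1, 3, 2]"
    then have len: "length xs = 3"
      by (simp add: order_isomorphic_def)
    then obtain a b c where xs: "xs = [a, b, c]"
      by (auto simp: numeral_3_eq_3 length_Suc_conv)
    have iff: "xs ! i < xs ! j \<longleftrightarrow> [1, 3, 2 :: nat] ! i < [1, 3, 2] ! j" if "i < 3" "j < 3" for i j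
      using * len that by (simp add: order_isomorphic_def)
    show "\<exists>a b c. xs = [a, b, c] \<and> a < c \<and> c < b"
      using iff [of 0 2] iff [of 2 1] xs by auto
  next
    assume "\<exists>a b c. xs = [a, b, c] \<and> a < c \<and> c < b"
    then show "order_isomorphic xs [1, 3, 2]"
      by (auto simp: order_isomorphic_def less_Suc_eq)
  qed
  show ?thesis
    unfolding avoids_def iff by blast
qed

text \<open>The comparisons within the increasing part and those with the final minimum determine
  all others. The index \<open>Suc n\<close> gives the increasing part exactly \<open>n\<close>
  letters.\<close>

lemma order_isomorphic_pattern_sigma_iff:
  "order_isomorphic zs (pattern_sigma (Suc n)) \<longleftrightarrow>
     (\<exists>xs y. zs = xs @ [y] \<and> length xs = n \<and> sorted_wrt (<) xs \<and> (\<forall>x\<in>set xs. y < x))"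
proof
  have nth: "pattern_sigma (Suc n) ! i = (if i < n then i + 2 else 1)" if "i \<le> n" for i
    using that by (auto simp: pattern_sigma_def nth_append simp del: upt_Suc)
  {
    assume *: "order_isomorphic zs (pattern_sigma (Suc n))"
    then have len: "length zs = Suc n"
      by (simp add: order_isomorphic_def pattern_sigma_def del: upt_Suc)
    then obtain xs y where zs: "zs = xs @ [y]"
      by (metis length_Suc_conv_rev)
    have iff: "zs ! i < zs ! j \<longleftrightarrow> pattern_sigma (Suc n) ! i < pattern_sigma (Suc n) ! j"
      if "i \<le> n" "j \<le> n" for i j
      using * len that by (simp add: order_isomorphic_def)
    have "xs ! i < xs ! j" if "i < j" "j < n" for i j
      using iff [of i j] that len by (simp add: nth zs nth_append)
    moreover have "y < xs ! i" if "i < n" for i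
      using iff [of n i] that len by (simp add: nth zs nth_append)
    ultimately show "\<exists>xs y. zs = xs @ [y] \<and> length xs = n \<and> sorted_wrt (<) xs \<and> (\<forall>x\<in>set xs. y < x)"
      using zs len by (auto simp: sorted_wrt_iff_nth_less in_set_conv_nth)
  }
  {
    assume "\<exists>xs y. zs = xs @ [y] \<and> length xs = n \<and> sorted_wrt (<) xs \<and> (\<forall>x\<in>set xs. y < x)"
    then obtain xs y where zs: "zs = xs @ [y]" and len: "length xs = n"
      and inc: "\<And>i j. i < j \<Longrightarrow> j < n \<Longrightarrow> xs ! i < xs ! j" and y: "\<And>i. i < n \<Longrightarrow> y < xs ! i"
      by (auto simp: sorted_wrt_iff_nth_less)
    have "zs ! i < zs ! j \<longleftrightarrow> pattern_sigma (Suc n) ! i < pattern_sigma (Suc n) ! j"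
      if "i \<le> n" "j \<le> n" for i j
    proof -
      have "xs ! i < xs ! j \<longleftrightarrow> i < j" if "i < n" "j < n"
        using inc [of i j] inc [of j i] that by (cases i j rule: linorder_cases) auto
      then show ?thesis
        using that y [of i] y [of j] len by (auto simp: nth zs nth_append)
    qed
    then show "order_isomorphic zs (pattern_sigma (Suc n))"
      using zs len
      by (simp add: order_isomorphic_def less_Suc_eq_le) (simp add: pattern_sigma_def del: upt_Suc)
  }
qed

lemma avoids_pattern_sigma_iff:
  "avoids \<pi> (pattern_sigma (Suc (Suc n))) \<longleftrightarrow> inc_over_bound n \<pi>"
proof -
  have "\<exists>ys. subseq (ys @ [y]) \<pi> \<and> length ys = Suc n \<and> sorted_wrt (<) ys \<and> (\<forall>x\<in>set ys. y < x)"
    if "subseq (xs @ [y]) \<pi>" "sorted_wrt (<) xs" "\<forall>x\<in>set xs. y < x" "\<not> length xs \<le> n" for xs y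
  proof (intro exI conjI)
    \<comment> \<open>An occurrence needs exactly \<open>Suc n\<close> letters above its last one: a
      longer increasing sequence is cut to a prefix and keeps the small letter \<open>y\<close> at
      its end.\<close>
    have "subseq (take (Suc n) xs @ [y]) (xs @ [y])"
      by (intro list_emb_append_mono prefix_imp_subseq) (auto simp: take_is_prefix)
    then show "subseq (take (Suc n) xs @ [y]) \<pi>"
      using that(1) subseq_order.trans by blast
  qed (use that in \<open>auto simp: sorted_wrt_take dest: in_set_takeD\<close>)
  then show ?thesis
    unfolding avoids_def inc_over_bound_def order_isomorphic_pattern_sigma_iff
    by (metis Suc_n_not_le_n)
qed

section \<open>Invariance under raising all letters by a constant\<close>

lemma subseq_map_iff: "subseq xs (map f ys) \<longleftrightarrow> (\<exists>zs. xs = map f zs \<and> subseq zs ys)"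
  by (auto simp: subseq_conv_nths nths_map)

lemma shift_invariant_avoids_132: "shift_invariant (\<lambda>\<pi>. avoids \<pi> [1, 3, 2])"
proof -
  have iff: "subseq [x, y, z] (map ((+) d) \<pi>) \<longleftrightarrow>
        (\<exists>a b c. x = d + a \<and> y = d + b \<and> z = d + c \<and> subseq [a, b, c] \<pi>)" for d x y z \<pi>
    by (auto simp: subseq_map_iff Cons_eq_map_conv) (metis list.simps(8,9))
  show ?thesis
    unfolding shift_invariant_def avoids_132_iff iff
    by (metis add_less_cancel_left)
qed

lemma sorted_wrt_less_shift: "sorted_wrt (<) (map ((+) (c :: nat)) xs) \<longleftrightarrow> sorted_wrt (<) xs"
  by (simp add: sorted_wrt_map)

lemma shift_invariant_inc_bound: "shift_invariant (inc_bound m)"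
  unfolding shift_invariant_def inc_bound_def subseq_map_iff
  by (auto simp: sorted_wrt_less_shift)

lemma shift_invariant_inc_over_bound: "shift_invariant (inc_over_bound m)"
proof -
  have "inc_over_bound m (map ((+) c) \<pi>)" if "inc_over_bound m \<pi>" for c \<pi>
    unfolding inc_over_bound_def subseq_map_iff
  proof (intro allI impI)
    fix xs y
    assume *: "\<exists>zs. xs @ [y] = map ((+) c) zs \<and> subseq zs \<pi>" "sorted_wrt (<) xs" "\<forall>x\<in>set xs. y < x"
    then obtain us v where "xs = map ((+) c) us" "y = c + v" "subseq (us @ [v]) \<pi>"
      by (auto simp: append_eq_map_conv Cons_eq_map_conv)
    then show "length xs \<le> m"
      using that *(2,3) by (auto simp: inc_over_bound_def sorted_wrt_less_shift)
  qed
  moreover have "inc_over_bound m \<pi>" if *: "inc_over_bound m (map ((+) c) \<pi>)" for c \<pi>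
    unfolding inc_over_bound_def
  proof (intro allI impI)
    fix xs y
    assume "subseq (xs @ [y]) \<pi>" "sorted_wrt (<) xs" "\<forall>x\<in>set xs. y < x"
    then have "subseq (map ((+) c) xs @ [c + y]) (map ((+) c) \<pi>)"
      "sorted_wrt (<) (map ((+) c) xs)" "\<forall>x\<in>set (map ((+) c) xs). c + y < x"
      by (auto simp: subseq_map_iff sorted_wrt_less_shift intro!: exI [of _ "xs @ [y]"])
    then have "length (map ((+) c) xs) \<le> m"
      using * unfolding inc_over_bound_def by blast
    then show "length xs \<le> m"
      by simp
  qed
  ultimately show ?thesis
    unfolding shift_invariant_def by blast
qed

lemma shift_invariant_alternating: "shift_invariant (alternating b)"
  unfolding shift_invariant_def alternating_def by simp

subsection \<open>Splitting a word at its maximum\<close>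

lemma subseq_set_mono: "subseq xs ys \<Longrightarrow> set xs \<subseteq> set ys"
  by (auto elim: list_emb_set)

lemma subseq_middle: "subseq L (L @ x # R)" "subseq R (L @ x # R)"
  using subseq_rev_drop_many [of L L "x # R"] subseq_drop_many [of R R "L @ [x]"] by simp_all

lemma subseq_middleE:
  assumes "subseq zs (L @ x # R)"
  obtains us vs where "zs = us @ vs" "subseq us L" "subseq vs R"
  | us vs where "zs = us @ x # vs" "subseq us L" "subseq vs R"
proof -
  obtain us ws where zs: "zs = us @ ws" "subseq us L" and ws: "subseq ws (x # R)"
    using assms by (auto simp: subseq_append_iff)
  show thesis
  proof (cases ws)
    case Nil
    then show thesis using zs that(1) [of us "[]"] by auto
  next
    case (Cons w vs)
    then show thesis
      using ws zs that(1) [of us ws] that(2) [of us vs] by (auto simp: subseq_Cons' split: if_splits)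
  qed
qed

context
  fixes L R :: "nat list" and x :: nat
  assumes L_below: "\<forall>l\<in>set L. l < x"
    and R_below: "\<forall>r\<in>set R. r < x"
begin

private lemma L_less: "l \<in> set L \<Longrightarrow> l < x"
  using L_below by blast

private lemma R_less: "r \<in> set R \<Longrightarrow> r < x"
  using R_below by blast

text \<open>The letter \<open>x\<close> exceeds its neighbours, so the step into it ascends and the
  step out of it descends; either one fixes the parity of its position \<open>length L\<close>. The
  word \<open>R\<close> starts at position \<open>length L + 1\<close>, whose parity gives its
  direction. After the descent from \<open>x\<close>, a nonempty \<open>R\<close> always starts in
  the ascending direction.\<close>

lemma alternating_middle_iff:
  "alternating b (L @ x # R) \<longleftrightarrow>
     alternating b L \<and> alternating (if even (length L) then \<not> b else b) R \<and>
     (L \<noteq> [] \<longrightarrow> even (length L) \<noteq> b) \<and> (R \<noteq> [] \<longrightarrow> even (length L) \<noteq> b)"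
  (is "?lhs \<longleftrightarrow> ?rhs")
proof
  let ?\<pi> = "L @ x # R"
  let ?step = "\<lambda>b \<pi> i. if even i = b then \<pi> ! i < \<pi> ! Suc i else (\<pi> ! i :: nat) > \<pi> ! Suc i"
  have nL: "?\<pi> ! i = L ! i" if "i < length L" for i
    using that by (simp add: nth_append)
  have nx: "?\<pi> ! length L = x"
    by simp
  have nR: "?\<pi> ! (Suc (length L + i)) = R ! i" for i
    by (simp add: nth_append)
  {
    assume ?lhs
    then have step: "?step b ?\<pi> i" if "i < length L + length R" for i
      using that unfolding alternating_def by simp
    have "?step b L i" if "Suc i < length L" for i
      using step [of i] that nL [of i] nL [of "Suc i"] by (auto split: if_splits)
    moreover have "?step (if even (length L) then \<not> b else b) R i" if "Suc i < length R" for i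
      using step [of "Suc (length L + i)"] that nR [of i] nR [of "Suc i"] by (auto split: if_splits)
    moreover have "even (length L) \<noteq> b" if ne: "L \<noteq> []"
    proof -
      obtain i where i: "length L = Suc i"
        using ne by (cases L) auto
      then have "?\<pi> ! i < ?\<pi> ! Suc i"
        using nL [of i] nx L_less [of "L ! i"] by auto
      then show ?thesis
        using step [of i] i by (auto split: if_splits)
    qed
    moreover have "even (length L) \<noteq> b" if "R \<noteq> []"
    proof -
      have "?\<pi> ! Suc (length L) < ?\<pi> ! length L"
        using nR [of 0] nx R_less [of "R ! 0"] that by auto
      then show ?thesis
        using step [of "length L"] that by (auto split: if_splits)
    qed
    ultimately show ?rhs
      unfolding alternating_def by blast
  }
  {
    assume ?rhs
    then have sL: "?step b L i" if "Suc i < length L" for i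
      using that unfolding alternating_def by blast
    have sR: "?step (if even (length L) then \<not> b else b) R i" if "Suc i < length R" for i
      using \<open>?rhs\<close> that unfolding alternating_def by blast
    have "?step b ?\<pi> i" if i: "Suc i < length ?\<pi>" for i
    proof -
      consider "Suc i < length L" | "Suc i = length L" | "i = length L"
        | j where "i = Suc (length L + j)" "Suc j < length R"
      proof (cases "i \<le> length L")
        case True
        then show ?thesis
          using that(1-3) by linarith
      next
        case False
        then show ?thesis
          using that(4) [of "i - Suc (length L)"] i by simp
      qed
      then show ?thesis
      proof cases
        case 1
        then show ?thesis using sL nL [of i] nL [of "Suc i"] by (auto split: if_splits)
      next
        case 2
        then have "?\<pi> ! i < ?\<pi> ! Suc i"
          using nL [of i] nx L_less [of "L ! i"] by auto
        moreover have "even i = b"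
          using \<open>?rhs\<close> 2 by (cases L) auto
        ultimately show ?thesis by simp
      next
        case 3
        then have "R \<noteq> []"
          using i by auto
        then have "?\<pi> ! Suc i < ?\<pi> ! i" "even i \<noteq> b"
          using 3 nR [of 0] nx R_less [of "R ! 0"] \<open>?rhs\<close> by auto
        then show ?thesis by simp
      next
        case 4
        then show ?thesis
          using sR [of j] nR [of j] nR [of "Suc j"] by (auto split: if_splits)
      qed
    qed
    then show ?lhs
      unfolding alternating_def by blast
  }
qed

text \<open>A letter of \<open>L\<close>, then \<open>x\<close>, then a larger letter of
  \<open>R\<close> form a 132, so \<open>R\<close> must lie below \<open>L\<close>. Conversely, an
  occurrence that uses \<open>x\<close> can use it only as the 3, and one that meets both
  \<open>L\<close> and \<open>R\<close> has its 1 in \<open>L\<close> and its 2 in \<open>R\<close>,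
  against the order of the two factors.\<close>

lemma avoids_132_middle_iff:
  assumes "set L \<inter> set R = {}"
  shows "avoids (L @ x # R) [1, 3, 2] \<longleftrightarrow>
     avoids L [1, 3, 2] \<and> avoids R [1, 3, 2] \<and> (\<forall>l\<in>set L. \<forall>r\<in>set R. r < l)" (is "?lhs \<longleftrightarrow> ?rhs")
proof
  assume lhs: ?lhs
  have "r < l" if "l \<in> set L" "r \<in> set R" for l r
  proof (rule ccontr)
    assume "\<not> r < l"
    moreover have "l \<noteq> r"
      using that assms by blast
    ultimately have "l < r"
      by simp
    moreover have "subseq ([l] @ [x] @ [r]) (L @ [x] @ R)"
      using that by (intro list_emb_append_mono) (simp_all add: subseq_singleton_left)
    then have "subseq [l, x, r] (L @ x # R)"
      by (simp only: append.simps)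
    ultimately show False
      using lhs R_less [OF that(2)] unfolding avoids_132_iff by blast
  qed
  moreover have sub: "subseq zs (L @ x # R)" if "subseq zs L \<or> subseq zs R" for zs
    using that subseq_middle subseq_order.trans by blast
  then have "avoids L [1, 3, 2]" "avoids R [1, 3, 2]"
    using lhs unfolding avoids_132_iff by blast+
  ultimately show ?rhs
    by blast
next
  assume rhs: ?rhs
  then have avL: "\<not> subseq [a, b, c] L" and avR: "\<not> subseq [a, b, c] R" if "a < c" "c < b" for a b c
    using that unfolding avoids_132_iff by blast+
  have False if "subseq [a, b, c] (L @ x # R)" "a < c" "c < b" for a b c
    using that(1)
  proof (cases rule: subseq_middleE)
    case (1 us vs)
    have "set us \<subseteq> set L" "set vs \<subseteq> set R"
      using 1 subseq_set_mono by blast+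
    then show False
      using rhs that(2,3) avL avR 1 by (force simp: Cons_eq_append_conv)
  next
    case (2 us vs)
    have "set us \<subseteq> set L" "set vs \<subseteq> set R"
      using 2 subseq_set_mono by blast+
    then show False
      using rhs that(2,3) L_less R_less 2(1) by (force simp: Cons_eq_append_conv)
  qed
  then show ?lhs
    unfolding avoids_132_iff by blast
qed

text \<open>For an initial ascent the peak \<open>x\<close> needs \<open>L\<close> of odd length,
  for an initial descent of even length, and \<open>R\<close> then starts upwards; the total parity
  settles the length of \<open>R\<close>. Only in the first class does the one-letter word need its
  own clause, since there the empty \<open>L\<close> has the wrong parity.\<close>

lemma alternating_classes_middle_iff:
  shows odd_up_middle_iff:
      "odd_up (L @ x # R) \<longleftrightarrow> odd_up L \<and> odd_up R \<or> L = [] \<and> R = []"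
    and even_up_middle_iff: "even_up (L @ x # R) \<longleftrightarrow> odd_up L \<and> even_up R"
    and even_down_middle_iff: "even_down (L @ x # R) \<longleftrightarrow> even_down L \<and> odd_up R"
    and odd_down_middle_iff: "odd_down (L @ x # R) \<longleftrightarrow> even_down L \<and> even_up R"
  by (auto simp: alternating_middle_iff)

context
  assumes R_below_L: "\<forall>l\<in>set L. \<forall>r\<in>set R. r < l"
begin

private lemma R_less_L: "l \<in> set L \<Longrightarrow> r \<in> set R \<Longrightarrow> r < l"
  using R_below_L by blast

text \<open>Every increasing subsequence of \<open>L\<close> can be extended by \<open>x\<close>,
  which costs one unit of the bound. None can pass from \<open>L\<close> or \<open>x\<close> into
  the lower word \<open>R\<close>.\<close>

lemma inc_bound_middle_iff:
  "inc_bound (Suc m) (L @ x # R) \<longleftrightarrow> inc_bound m L \<and> inc_bound (Suc m) R" (is "?lhs \<longleftrightarrow> ?rhs")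
proof
  assume lhs: ?lhs
  have "length xs \<le> m" if xs: "subseq xs L" "sorted_wrt (<) xs" for xs
  proof -
    have "subseq (xs @ [x] @ []) (L @ [x] @ R)"
      using xs by (intro list_emb_append_mono) auto
    moreover have "sorted_wrt (<) (xs @ [x])"
      using xs subseq_set_mono [OF xs(1)] L_less by (auto simp: sorted_wrt_append)
    ultimately have "length (xs @ [x]) \<le> Suc m"
      using lhs unfolding inc_bound_def by (metis append_Cons append_Nil append_Nil2)
    then show ?thesis
      by simp
  qed
  moreover have "inc_bound (Suc m) R"
    using lhs subseq_middle(2) subseq_order.trans unfolding inc_bound_def by blast
  ultimately show ?rhs
    unfolding inc_bound_def by blast
next
  assume rhs: ?rhs
  have "length zs \<le> Suc m" if zs: "subseq zs (L @ x # R)" "sorted_wrt (<) zs" for zs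
    using zs(1)
  proof (cases rule: subseq_middleE)
    case (1 us vs)
    have "us = [] \<or> vs = []"
      using zs(2) 1 R_less_L subseq_set_mono [OF 1(2)] subseq_set_mono [OF 1(3)]
      by (cases us; cases vs) (fastforce simp: sorted_wrt_append)+
    moreover have "length us \<le> m" "length vs \<le> Suc m"
      using zs(2) 1 rhs by (auto simp: sorted_wrt_append inc_bound_def)
    ultimately show ?thesis
      using 1 by auto
  next
    case (2 us vs)
    have "vs = []"
      using zs(2) 2 R_less subseq_set_mono [OF 2(3)]
      by (cases vs) (fastforce simp: sorted_wrt_append)+
    moreover have "length us \<le> m"
      using zs(2) 2 rhs by (auto simp: sorted_wrt_append inc_bound_def)
    ultimately show ?thesis
      using 2 by auto
  qed
  then show ?lhs
    unfolding inc_bound_def by blast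
qed

text \<open>Any letter of \<open>R\<close> lies below \<open>L\<close> and \<open>x\<close>, so it
  completes an occurrence from an increasing subsequence of \<open>L\<close> followed by
  \<open>x\<close>; hence the bound \<open>m\<close> on \<open>L\<close>. Conversely, if the final
  small letter lies in \<open>R\<close>, the increasing part lies either wholly in \<open>R\<close>
  or wholly in \<open>L\<close> and \<open>x\<close>.\<close>

lemma inc_over_bound_middle_iff:
  "inc_over_bound (Suc m) (L @ x # R) \<longleftrightarrow>
     inc_over_bound (Suc m) L \<and> inc_over_bound (Suc m) R \<and> (R \<noteq> [] \<longrightarrow> inc_bound m L)"
  (is "?lhs \<longleftrightarrow> ?rhs")
proof
  assume lhs: ?lhs
  have "length xs \<le> m" if xs: "subseq xs L" "sorted_wrt (<) xs" and R: "R \<noteq> []" for xs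
  proof -
    have sub: "subseq (xs @ [x] @ [hd R]) (L @ [x] @ R)"
      using xs R by (intro list_emb_append_mono) (auto simp: subseq_singleton_left)
    have "set xs \<subseteq> set L" "hd R \<in> set R"
      using xs(1) R subseq_set_mono by auto
    then have "sorted_wrt (<) (xs @ [x])" "\<forall>y\<in>set (xs @ [x]). hd R < y"
      using xs(2) L_less R_less R_less_L by (auto simp: sorted_wrt_append)
    moreover have "subseq ((xs @ [x]) @ [hd R]) (L @ x # R)"
      using sub by simp
    ultimately have "length (xs @ [x]) \<le> Suc m"
      using lhs unfolding inc_over_bound_def by blast
    then show ?thesis
      by simp
  qed
  moreover have "inc_over_bound (Suc m) L" "inc_over_bound (Suc m) R"
    using lhs subseq_middle subseq_order.trans unfolding inc_over_bound_def by blast+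
  ultimately show ?rhs
    unfolding inc_bound_def by blast
next
  assume rhs: ?rhs
  have "length zs \<le> Suc m"
    if zs: "subseq (zs @ [y]) (L @ x # R)" "sorted_wrt (<) zs" "\<forall>z\<in>set zs. y < z" for zs y
    using zs(1)
  proof (cases rule: subseq_middleE)
    case (1 us vs)
    show ?thesis
    proof (cases vs rule: rev_cases)
      case Nil
      then show ?thesis
        using 1 zs rhs by (auto simp: inc_over_bound_def)
    next
      case (snoc vs' v)
      then have eq: "zs = us @ vs'" "v = y"
        using 1(1) by auto
      show ?thesis
      proof (cases "us = []")
        case True
        then show ?thesis
          using 1 zs rhs snoc eq by (auto simp: inc_over_bound_def)
      next
        case False
        then obtain u where "u \<in> set us"
          by (cases us) auto
        then have "vs' = []"
          using zs(2) eq snoc R_less_L subseq_set_mono [OF 1(2)] subseq_set_mono [OF 1(3)]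
          by (cases vs') (fastforce simp: sorted_wrt_append)+
        moreover have "R \<noteq> []"
          using 1(3) snoc by auto
        ultimately show ?thesis
          using eq zs(2) rhs 1(2) by (auto simp: inc_bound_def intro: le_SucI)
      qed
    qed
  next
    case (2 us vs)
    show ?thesis
    proof (cases vs rule: rev_cases)
      case Nil
      \<comment> \<open>The maximum lies below no letter, so as final letter it leaves the
        increasing part empty.\<close>
      then have "zs = us" "y = x"
        using 2(1) by auto
      then have "zs = []"
        using zs(3) L_less subseq_set_mono [OF 2(2)] by (cases zs) (fastforce simp: less_not_sym)+
      then show ?thesis
        by simp
    next
      case (snoc vs' v)
      then have eq: "zs = us @ x # vs'"
        using 2(1) by auto
      have "vs' = []"
        using zs(2) eq snoc R_less subseq_set_mono [OF 2(3)]
        by (cases vs') (fastforce simp: sorted_wrt_append)+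
      moreover have "R \<noteq> []"
        using 2(3) snoc by auto
      ultimately show ?thesis
        using eq zs(2) rhs 2(2) by (auto simp: inc_bound_def sorted_wrt_append)
    qed
  qed
  then show ?lhs
    unfolding inc_over_bound_def by blast
qed

end

end

subsection \<open>Counting \<open>132\<close>-avoiding permutations\<close>

definition av132 :: "nat \<Rightarrow> nat list set" where
  "av132 n = {\<pi> \<in> permutations_of_set {1..n}. avoids \<pi> [1, 3, 2]}"

lemma av132_iff: "\<pi> \<in> av132 n \<longleftrightarrow> set \<pi> = {1..n} \<and> distinct \<pi> \<and> avoids \<pi> [1, 3, 2]"
  by (auto simp: av132_def permutations_of_set_def)

lemma length_av132: "\<pi> \<in> av132 n \<Longrightarrow> length \<pi> = n"
  by (metis av132_iff card_atLeastAtMost diff_Suc_1 distinct_card)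

lemma finite_av132 [simp]: "finite (av132 n)"
  by (simp add: av132_def)

lemma av132_0: "av132 0 = {[]}"
  unfolding set_eq_iff av132_iff avoids_132_iff by auto

text \<open>A number up to \<open>Max B\<close> cannot belong to \<open>A\<close>, whose elements
  exceed all of \<open>B\<close>; so \<open>B\<close> is an initial segment. This makes the letters
  of both factors at the maximum a function of their lengths.\<close>

lemma separated_partition_atLeastAtMost:
  fixes A B :: "nat set"
  assumes "A \<union> B = {1..n}" "\<And>a b. a \<in> A \<Longrightarrow> b \<in> B \<Longrightarrow> b < a"
  shows "B = {1..card B}" "A = {card B + 1..n}"
proof -
  have sub: "A \<subseteq> {1..n}" "B \<subseteq> {1..n}"
    using assms(1) by blast+
  have fin: "finite B"
    using sub finite_subset by blast
  obtain m where m: "m \<le> n" "B = {1..m}"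
  proof (cases "B = {}")
    case True
    then show thesis
      using that [of 0] by simp
  next
    case False
    then have Max: "Max B \<in> B"
      using fin by simp
    have "c \<in> B" if "1 \<le> c" "c \<le> Max B" for c
    proof -
      have "c \<in> A \<union> B"
        unfolding assms(1) using that Max sub by auto
      moreover have "c \<notin> A"
        using assms(2) [of c "Max B"] Max that by auto
      ultimately show ?thesis
        by blast
    qed
    moreover have "1 \<le> b" "b \<le> Max B" if "b \<in> B" for b
      using that sub fin by auto
    ultimately have "B = {1..Max B}"
      unfolding set_eq_iff atLeastAtMost_iff by blast
    moreover have "Max B \<le> n"
      using Max sub by auto
    ultimately show thesis
      by (intro that)
  qed
  then show B: "B = {1..card B}"
    by simp
  have "A \<inter> B = {}"
    using assms(2) by blast
  then have "A = {1..n} - B"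
    using assms(1) by blast
  then show "A = {card B + 1..n}"
    using m by auto
qed

text \<open>Here \<open>i\<close> is the length of the left factor. As this factor lies above the
  right one, its letters are the \<open>i\<close> largest below \<open>Suc n\<close>, so it is a
  permutation of \<open>{1..i}\<close> raised by \<open>n - i\<close>.\<close>

lemma bij_betw_av132_Suc:
  "bij_betw (\<lambda>(i, L, R). map ((+) (n - i)) L @ Suc n # R)
     (SIGMA i:{..n}. av132 i \<times> av132 (n - i)) (av132 (Suc n))" (is "bij_betw ?f ?S _")
proof (rule bij_betwI')
  fix s t
  assume "s \<in> ?S" "t \<in> ?S"
  then obtain i L R j L' R' where s: "s = (i, L, R)" "i \<le> n" "L \<in> av132 i" "R \<in> av132 (n - i)"
    and t: "t = (j, L', R')" "j \<le> n" "L' \<in> av132 j" "R' \<in> av132 (n - j)"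
    by auto
  have notin: "Suc n \<notin> set (map ((+) (n - i)) L)" "Suc n \<notin> set R"
    using s by (auto simp: av132_iff)
  show "?f s = ?f t \<longleftrightarrow> s = t"
  proof
    assume "?f s = ?f t"
    then have eq: "map ((+) (n - i)) L = map ((+) (n - j)) L'" "R = R'"
      unfolding s(1) t(1) using append_Cons_eq_iff [OF notin] by auto
    then have "i = j"
      by (metis length_av132 length_map s(3) t(3))
    then show "s = t"
      using eq s t by (simp add: inj_map_eq_map)
  qed simp
next
  fix s
  assume "s \<in> ?S"
  then obtain i L R where s: "s = (i, L, R)" "i \<le> n" "L \<in> av132 i" "R \<in> av132 (n - i)"
    by auto
  let ?L = "map ((+) (n - i)) L"
  have setL: "set ?L = {Suc (n - i)..n}"
    using s(2,3) by (simp only: av132_iff set_map image_add_atLeastAtMost) simp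
  have setR: "set R = {1..n - i}" and dist: "distinct ?L" "distinct R"
    using s by (auto simp: av132_iff distinct_map)
  have "avoids ?L [1, 3, 2]" "avoids R [1, 3, 2]"
    using s shift_invariant_avoids_132 by (auto simp: av132_iff shift_invariant_def)
  then have "avoids (?L @ Suc n # R) [1, 3, 2]"
    by (subst avoids_132_middle_iff) (simp_all only: setL setR, auto)
  moreover have "set (?L @ Suc n # R) = {1..Suc n}"
    unfolding set_append list.set setL setR using s(2) by auto
  moreover have "distinct (?L @ Suc n # R)"
    using dist unfolding distinct_append distinct.simps list.set setL setR by auto
  ultimately show "?f s \<in> av132 (Suc n)"
    by (simp only: s(1) av132_iff prod.case)
next
  fix \<pi>
  assume "\<pi> \<in> av132 (Suc n)"
  then have \<pi>: "set \<pi> = {1..Suc n}" "distinct \<pi>" "avoids \<pi> [1, 3, 2]"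
    by (auto simp: av132_iff)
  then obtain L R where split: "\<pi> = L @ Suc n # R"
    using split_list [of "Suc n" \<pi>] by auto
  have un: "set L \<union> set R = {1..n}" and disj: "set L \<inter> set R = {}" "distinct L" "distinct R"
  proof -
    have "Suc n \<notin> set L \<union> set R"
      using \<pi>(2) split by auto
    moreover have "insert (Suc n) (set L \<union> set R) = insert (Suc n) {1..n}"
      using \<pi>(1) split by (auto simp: atLeastAtMostSuc_conv)
    moreover have "Suc n \<notin> {1..n}"
      by simp
    ultimately show "set L \<union> set R = {1..n}"
      by (metis Diff_insert_absorb)
  qed (use \<pi>(2) split in auto)
  have "set L \<subseteq> {1..n}" "set R \<subseteq> {1..n}"
    using un by blast+
  then have less: "\<forall>l\<in>set L. l < Suc n" "\<forall>r\<in>set R. r < Suc n"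
    by auto
  have av: "avoids L [1, 3, 2]" "avoids R [1, 3, 2]" "\<forall>l\<in>set L. \<forall>r\<in>set R. r < l"
    using avoids_132_middle_iff [OF less disj(1)] \<pi>(3) split by auto
  define j where "j = length R"
  have "card (set R) = j"
    using disj by (simp add: j_def distinct_card)
  then have R: "set R = {1..j}" and L: "set L = {j + 1..n}"
    using separated_partition_atLeastAtMost [OF un] av(3) by auto
  have j: "j \<le> n"
    using un R by (cases j) auto
  \<comment> \<open>This undoes the shift; the truncated subtraction is exact because all letters of
    \<open>L\<close> exceed \<open>j\<close>.\<close>
  define L' where "L' = map (\<lambda>a. a - j) L"
  have L'_eq: "L = map ((+) j) L'"
    unfolding L'_def by (auto simp: L intro!: map_idI [symmetric])
  have "L' \<in> av132 (n - j)"
  proof -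
    have "avoids L' [1, 3, 2]"
      using av(1) shift_invariant_avoids_132 unfolding L'_eq shift_invariant_def by blast
    moreover have "distinct L'"
      using disj(2) unfolding L'_eq by (simp add: distinct_map)
    moreover have "set L' = {1..n - j}"
    proof -
      have "(+) j ` set L' = (+) j ` {1..n - j}"
        using L j unfolding L'_eq by simp
      then show ?thesis
        by (subst (asm) inj_image_eq_iff) simp_all
    qed
    ultimately show ?thesis
      by (simp add: av132_iff)
  qed
  moreover have "R \<in> av132 (n - (n - j))"
    using R disj av j by (simp add: av132_iff)
  ultimately show "\<exists>s\<in>?S. \<pi> = ?f s"
    using j by (intro bexI [of _ "(n - j, L', R)"]) (auto simp: split L'_eq)
qed

section \<open>Generating functions of classes of 132-avoiding permutations\<close>

definition class_count :: "(nat list \<Rightarrow> bool) \<Rightarrow> nat \<Rightarrow> nat" where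
  "class_count P n = card {\<pi> \<in> av132 n. P \<pi>}"

abbreviation class_gf :: "(nat list \<Rightarrow> bool) \<Rightarrow> real fps" where
  "class_gf P \<equiv> gen_fun (class_count P)"

text \<open>The bijection turns each alternative for the pair of factors into a Cauchy product, and
  \<open>fps_X\<close> marks the maximum. Two exclusive alternatives cover all later equations: the
  second handles the one-letter word or an empty right factor, or is filled with
  \<open>False\<close>. Invariance is asked of \<open>P\<close> and \<open>P'\<close> because it is
  the left factor that is shifted.\<close>

lemma class_gf_decomposition:
  assumes inv: "shift_invariant P" "shift_invariant P'"
    and iff: "\<And>L x R. \<lbrakk>\<forall>l\<in>set L. l < x; \<forall>r\<in>set R. r < x; \<forall>l\<in>set L. \<forall>r\<in>set R. r < l\<rbrakk> \<Longrightarrow>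
        Q (L @ x # R) \<longleftrightarrow> P L \<and> S R \<or> P' L \<and> S' R"
    and disj: "\<And>L R. \<not> (P L \<and> S R \<and> P' L \<and> S' R)"
  shows "class_gf Q = (if Q [] then 1 else 0) +
    fps_X * (class_gf P * class_gf S + class_gf P' * class_gf S')"
proof -
  have rec: "class_count Q (Suc n) = (\<Sum>i\<le>n. class_count P i * class_count S (n - i) +
      class_count P' i * class_count S' (n - i))" for n
  proof -
    let ?f = "\<lambda>(i, L, R). map ((+) (n - i)) L @ Suc n # R"
    let ?A = "SIGMA i:{..n}. av132 i \<times> av132 (n - i)"
    let ?C = "\<lambda>T i. {\<pi> \<in> av132 i. T \<pi>}"
    have Q_iff: "Q (?f (i, L, R)) \<longleftrightarrow> P L \<and> S R \<or> P' L \<and> S' R"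
      if "i \<le> n" "L \<in> av132 i" "R \<in> av132 (n - i)" for i L R
    proof -
      have "Q (map ((+) (n - i)) L @ Suc n # R) \<longleftrightarrow>
          P (map ((+) (n - i)) L) \<and> S R \<or> P' (map ((+) (n - i)) L) \<and> S' R"
        using that by (intro iff) (auto simp: av132_iff)
      then show ?thesis
        using inv by (simp add: shift_invariant_def)
    qed
    have bij: "inj_on ?f ?A" "?f ` ?A = av132 (Suc n)"
      using bij_betw_av132_Suc [of n] by (auto simp: bij_betw_def)
    have "?C Q (Suc n) = ?f ` {s \<in> ?A. Q (?f s)}"
      unfolding bij(2) [symmetric] by blast
    moreover have "inj_on ?f {s \<in> ?A. Q (?f s)}"
      using bij(1) by (rule inj_on_subset) blast
    ultimately have "class_count Q (Suc n) = card {s \<in> ?A. Q (?f s)}"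
      unfolding class_count_def by (simp only: card_image)
    also have "{s \<in> ?A. Q (?f s)} =
        (SIGMA i:{..n}. ?C P i \<times> ?C S (n - i) \<union> ?C P' i \<times> ?C S' (n - i))"
      using Q_iff by auto
    also have "card \<dots> = (\<Sum>i\<le>n. card (?C P i \<times> ?C S (n - i) \<union> ?C P' i \<times> ?C S' (n - i)))"
      by (intro card_SigmaI) auto
    also have "\<dots> = (\<Sum>i\<le>n. class_count P i * class_count S (n - i) +
      class_count P' i * class_count S' (n - i))"
    proof (intro sum.cong refl)
      fix i
      have "?C P i \<times> ?C S (n - i) \<inter> ?C P' i \<times> ?C S' (n - i) = {}"
        using disj by blast
      then show "card (?C P i \<times> ?C S (n - i) \<union> ?C P' i \<times> ?C S' (n - i)) =
          class_count P i * class_count S (n - i) + class_count P' i * class_count S' (n - i)"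
        by (subst card_Un_disjoint) (auto simp: card_cartesian_product class_count_def)
    qed
    finally show ?thesis .
  qed
  show ?thesis
  proof (rule fps_ext)
    fix n
    show "fps_nth (class_gf Q) n = fps_nth ((if Q [] then 1 else 0) +
      fps_X * (class_gf P * class_gf S + class_gf P' * class_gf S')) n"
    proof (cases n)
      case 0
      then show ?thesis
        by (simp add: gen_fun_def class_count_def av132_0 Collect_conv_if)
    next
      case (Suc m)
      have "fps_nth (class_gf Q) n =
          fps_nth (class_gf P * class_gf S + class_gf P' * class_gf S') m"
        by (simp add: Suc gen_fun_def rec fps_mult_nth sum.distrib atLeast0AtMost)
      then show ?thesis
        by (simp add: Suc)
    qed
  qed
qed

lemma class_gf_Nil: "class_gf (\<lambda>\<pi>. \<pi> = []) = 1"
proof (rule fps_ext)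
  fix n
  have "{\<pi> \<in> av132 n. \<pi> = []} = (if n = 0 then {[]} else {})"
    by (auto simp: av132_0 dest: length_av132)
  then show "fps_nth (class_gf (\<lambda>\<pi>. \<pi> = [])) n = fps_nth 1 n"
    by (simp add: gen_fun_def class_count_def)
qed

lemma class_gf_False: "class_gf (\<lambda>\<pi>. False) = 0"
  by (rule fps_ext) (simp add: gen_fun_def class_count_def)

subsection \<open>Functional equations\<close>

lemmas shift_simps =
  shift_invariant_alternating [unfolded shift_invariant_def, rule_format]
  shift_invariant_inc_bound [unfolded shift_invariant_def, rule_format]
  shift_invariant_inc_over_bound [unfolded shift_invariant_def, rule_format]

lemma inc_bound_Nil [simp]: "inc_bound m []"
  by (auto simp: inc_bound_def dest: list_emb_Nil2)

lemma inc_over_bound_Nil [simp]: "inc_over_bound m []"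
  by (simp add: inc_over_bound_def)

lemma inc_bound_0_iff: "inc_bound 0 \<pi> \<longleftrightarrow> \<pi> = []"
proof
  assume *: "inc_bound 0 \<pi>"
  show "\<pi> = []"
  proof (cases \<pi>)
    case (Cons a as)
    then show ?thesis
      using * unfolding inc_bound_def by (auto dest!: spec [of _ "[a]"])
  qed
qed simp

text \<open>When the right factor is nonempty, this absorbs the sigma condition on the left factor
  into the stronger bound on increasing subsequences.\<close>

lemma inc_bound_imp_inc_over_bound: "inc_bound m \<pi> \<Longrightarrow> inc_over_bound (Suc m) \<pi>"
  unfolding inc_bound_def inc_over_bound_def
  by (meson le_SucI subseq_order.trans subseq_rev_drop_many subseq_order.refl)

lemma class_gf_odd_up_inc_bound_0: "class_gf (\<lambda>\<pi>. odd_up \<pi> \<and> inc_bound 0 \<pi>) = 0"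
proof -
  have "(\<lambda>\<pi>. odd_up \<pi> \<and> inc_bound 0 \<pi>) = (\<lambda>\<pi>. False)"
    by (auto simp: inc_bound_0_iff)
  then show ?thesis
    using class_gf_False by simp
qed

text \<open>The summand 1 comes from the one-letter word, which is the second alternative of the
  decomposition.\<close>

lemma class_gf_odd_up_inc_bound_Suc:
  "class_gf (\<lambda>\<pi>. odd_up \<pi> \<and> inc_bound (Suc m) \<pi>) =
     fps_X * (class_gf (\<lambda>\<pi>. odd_up \<pi> \<and> inc_bound m \<pi>) *
              class_gf (\<lambda>\<pi>. odd_up \<pi> \<and> inc_bound (Suc m) \<pi>) + 1)"
  (is "class_gf ?Q = fps_X * (class_gf ?P * _ + 1)")
proof -
  have split: "?Q (L @ x # R) \<longleftrightarrow> ?P L \<and> ?Q R \<or> L = [] \<and> R = []"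
    if "\<forall>l\<in>set L. l < x" "\<forall>r\<in>set R. r < x" "\<forall>l\<in>set L. \<forall>r\<in>set R. r < l" for L x R
    unfolding odd_up_middle_iff [OF that(1,2)] inc_bound_middle_iff [OF that] by auto
  show ?thesis
    by (rule trans [OF class_gf_decomposition [where Q = ?Q and P = ?P and S = ?Q and
      P' = "\<lambda>\<pi>. \<pi> = []" and S' = "\<lambda>\<pi>. \<pi> = []", OF _ _ split]])
      (auto simp: shift_invariant_def shift_simps class_gf_Nil)
qed

lemma class_gf_even_down_inc_bound_0: "class_gf (\<lambda>\<pi>. even_down \<pi> \<and> inc_bound 0 \<pi>) = 1"
proof -
  have "(\<lambda>\<pi>. even_down \<pi> \<and> inc_bound 0 \<pi>) = (\<lambda>\<pi>. \<pi> = [])"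
    by (auto simp: inc_bound_0_iff)
  then show ?thesis
    using class_gf_Nil by simp
qed

lemma class_gf_even_down_inc_bound_Suc:
  "class_gf (\<lambda>\<pi>. even_down \<pi> \<and> inc_bound (Suc m) \<pi>) =
     1 + fps_X * (class_gf (\<lambda>\<pi>. even_down \<pi> \<and> inc_bound m \<pi>) *
                  class_gf (\<lambda>\<pi>. odd_up \<pi> \<and> inc_bound (Suc m) \<pi>))"
  (is "class_gf ?Q = 1 + fps_X * (class_gf ?P * class_gf ?R)")
proof -
  have split: "?Q (L @ x # R) \<longleftrightarrow> ?P L \<and> ?R R \<or> False \<and> False"
    if "\<forall>l\<in>set L. l < x" "\<forall>r\<in>set R. r < x" "\<forall>l\<in>set L. \<forall>r\<in>set R. r < l" for L x R
    unfolding even_down_middle_iff [OF that(1,2)] inc_bound_middle_iff [OF that] by auto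
  show ?thesis
    by (rule trans [OF class_gf_decomposition [where Q = ?Q and P = ?P and S = ?R and
      P' = "\<lambda>\<pi>. False" and S' = "\<lambda>\<pi>. False", OF _ _ split]])
      (auto simp: shift_invariant_def shift_simps class_gf_False)
qed

text \<open>Beyond the one-letter word the right factor has odd length and is nonempty, so the left
  factor always satisfies \<open>inc_bound m\<close>. The equation has the same shape as the one for
  \<open>inc_bound (Suc m)\<close>.\<close>

lemma class_gf_odd_up_inc_over_bound:
  "class_gf (\<lambda>\<pi>. odd_up \<pi> \<and> inc_over_bound (Suc m) \<pi>) =
     fps_X * (class_gf (\<lambda>\<pi>. odd_up \<pi> \<and> inc_bound m \<pi>) *
              class_gf (\<lambda>\<pi>. odd_up \<pi> \<and> inc_over_bound (Suc m) \<pi>) + 1)"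
  (is "class_gf ?Q = fps_X * (class_gf ?P * _ + 1)")
proof -
  have split: "?Q (L @ x # R) \<longleftrightarrow> ?P L \<and> ?Q R \<or> L = [] \<and> R = []"
    if "\<forall>l\<in>set L. l < x" "\<forall>r\<in>set R. r < x" "\<forall>l\<in>set L. \<forall>r\<in>set R. r < l" for L x R
    unfolding odd_up_middle_iff [OF that(1,2)] inc_over_bound_middle_iff [OF that]
    by (auto dest: inc_bound_imp_inc_over_bound)
  show ?thesis
    by (rule trans [OF class_gf_decomposition [where Q = ?Q and P = ?P and S = ?Q and
      P' = "\<lambda>\<pi>. \<pi> = []" and S' = "\<lambda>\<pi>. \<pi> = []", OF _ _ split]])
      (auto simp: shift_invariant_def shift_simps class_gf_Nil)
qed

section \<open>Equations for the four families of the theorem\<close>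

lemma class_gf_up_down:
  "class_gf (\<lambda>\<pi>. odd_up \<pi> \<and> inc_over_bound (Suc m) \<pi> \<and> 2 \<le> length \<pi>) =
     fps_X * (class_gf (\<lambda>\<pi>. odd_up \<pi> \<and> inc_bound m \<pi>) *
              class_gf (\<lambda>\<pi>. odd_up \<pi> \<and> inc_over_bound (Suc m) \<pi>))"
  (is "class_gf ?Q = fps_X * (class_gf ?P * class_gf ?R)")
proof -
  \<comment> \<open>The length condition removes the one-letter word, hence the second
    alternative.\<close>
  have split: "?Q (L @ x # R) \<longleftrightarrow> ?P L \<and> ?R R \<or> False \<and> False"
    if "\<forall>l\<in>set L. l < x" "\<forall>r\<in>set R. r < x" "\<forall>l\<in>set L. \<forall>r\<in>set R. r < l" for L x R
    unfolding odd_up_middle_iff [OF that(1,2)] inc_over_bound_middle_iff [OF that]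
    by (cases L; cases R) (auto dest: inc_bound_imp_inc_over_bound)
  show ?thesis
    by (rule trans [OF class_gf_decomposition [where Q = ?Q and P = ?P and S = ?R and
      P' = "\<lambda>\<pi>. False" and S' = "\<lambda>\<pi>. False", OF _ _ split]])
      (auto simp: shift_invariant_def shift_simps class_gf_False)
qed

text \<open>The right factor has odd length, so it is nonempty and forces \<open>inc_bound m\<close>
  on the left one. The length condition drops the empty word.\<close>

lemma class_gf_down_down:
  "class_gf (\<lambda>\<pi>. even_down \<pi> \<and> inc_over_bound (Suc m) \<pi> \<and> 2 \<le> length \<pi>) =
     fps_X * (class_gf (\<lambda>\<pi>. even_down \<pi> \<and> inc_bound m \<pi>) *
              class_gf (\<lambda>\<pi>. odd_up \<pi> \<and> inc_over_bound (Suc m) \<pi>))"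
  (is "class_gf ?Q = fps_X * (class_gf ?P * class_gf ?R)")
proof -
  have split: "?Q (L @ x # R) \<longleftrightarrow> ?P L \<and> ?R R \<or> False \<and> False"
    if "\<forall>l\<in>set L. l < x" "\<forall>r\<in>set R. r < x" "\<forall>l\<in>set L. \<forall>r\<in>set R. r < l" for L x R
    unfolding even_down_middle_iff [OF that(1,2)] inc_over_bound_middle_iff [OF that]
    by (cases L; cases R) (auto dest: inc_bound_imp_inc_over_bound)
  show ?thesis
    by (rule trans [OF class_gf_decomposition [where Q = ?Q and P = ?P and S = ?R and
      P' = "\<lambda>\<pi>. False" and S' = "\<lambda>\<pi>. False", OF _ _ split]])
      (auto simp: shift_invariant_def shift_simps class_gf_False)
qed

text \<open>The right factor has even length and may be empty. If it is, the left factor only has to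
  avoid sigma; if not, the left factor is subject to \<open>inc_bound m\<close>. The length
  condition in the first product keeps the two cases apart.\<close>

lemma class_gf_up_up:
  "class_gf (\<lambda>\<pi>. even_up \<pi> \<and> inc_over_bound (Suc m) \<pi> \<and> 2 \<le> length \<pi>) =
     fps_X * (class_gf (\<lambda>\<pi>. odd_up \<pi> \<and> inc_bound m \<pi>) *
              class_gf (\<lambda>\<pi>. even_up \<pi> \<and> inc_over_bound (Suc m) \<pi> \<and> 2 \<le> length \<pi>) +
              class_gf (\<lambda>\<pi>. odd_up \<pi> \<and> inc_over_bound (Suc m) \<pi>))"
  (is "class_gf ?Q = fps_X * (class_gf ?P1 * _ + class_gf ?P2)")
proof -
  have split: "?Q (L @ x # R) \<longleftrightarrow> ?P1 L \<and> ?Q R \<or> ?P2 L \<and> R = []"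
    if "\<forall>l\<in>set L. l < x" "\<forall>r\<in>set R. r < x" "\<forall>l\<in>set L. \<forall>r\<in>set R. r < l" for L x R
    unfolding even_up_middle_iff [OF that(1,2)] inc_over_bound_middle_iff [OF that]
    \<comment> \<open>The rule distinguishes lengths 0, 1 and at least 2, which decides the length
      condition.\<close>
    by (cases L; cases R rule: remdups_adj.cases) (auto dest: inc_bound_imp_inc_over_bound)
  show ?thesis
    by (rule trans [OF class_gf_decomposition [where Q = ?Q and P = ?P1 and S = ?Q and
      P' = ?P2 and S' = "\<lambda>\<pi>. \<pi> = []", OF _ _ split]])
      (auto simp: shift_invariant_def shift_simps class_gf_Nil)
qed

text \<open>As for up-up, the cases are a nonempty and an empty right factor. In the latter the left
  factor must have length at least 2, as the one-letter word is excluded.\<close>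

lemma class_gf_down_up:
  "class_gf (\<lambda>\<pi>. odd_down \<pi> \<and> inc_over_bound (Suc m) \<pi> \<and> 2 \<le> length \<pi>) =
     fps_X * (class_gf (\<lambda>\<pi>. even_down \<pi> \<and> inc_bound m \<pi>) *
              class_gf (\<lambda>\<pi>. even_up \<pi> \<and> inc_over_bound (Suc m) \<pi> \<and> 2 \<le> length \<pi>) +
              class_gf (\<lambda>\<pi>. even_down \<pi> \<and> inc_over_bound (Suc m) \<pi> \<and> 2 \<le> length \<pi>))"
  (is "class_gf ?Q = fps_X * (class_gf ?P1 * class_gf ?R1 + class_gf ?P2)")
proof -
  have split: "?Q (L @ x # R) \<longleftrightarrow> ?P1 L \<and> ?R1 R \<or> ?P2 L \<and> R = []"
    if "\<forall>l\<in>set L. l < x" "\<forall>r\<in>set R. r < x" "\<forall>l\<in>set L. \<forall>r\<in>set R. r < l" for L x R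
    unfolding odd_down_middle_iff [OF that(1,2)] inc_over_bound_middle_iff [OF that]
    by (cases L rule: remdups_adj.cases; cases R rule: remdups_adj.cases)
      (auto dest: inc_bound_imp_inc_over_bound)
  show ?thesis
    by (rule trans [OF class_gf_decomposition [where Q = ?Q and P = ?P1 and S = ?R1 and
      P' = ?P2 and S' = "\<lambda>\<pi>. \<pi> = []", OF _ _ split]])
      (auto simp: shift_invariant_def shift_simps class_gf_Nil)
qed

text \<open>With k = m + 3, sigma has k - 1 increasing letters, so at most k - 2 =
  \<open>Suc m\<close> are allowed above a later letter. The length condition encodes that the
  classes are empty for n = 0 and n = 1.\<close>

lemma class_counts:
  shows ud_eq: "ud (m + 3) = class_count (\<lambda>\<pi>. odd_up \<pi> \<and> inc_over_bound (Suc m) \<pi> \<and> 2 \<le> length \<pi>)"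
    and dd_eq: "dd (m + 3) = class_count (\<lambda>\<pi>. even_down \<pi> \<and> inc_over_bound (Suc m) \<pi> \<and> 2 \<le> length \<pi>)"
    and uu_eq: "uu (m + 3) = class_count (\<lambda>\<pi>. even_up \<pi> \<and> inc_over_bound (Suc m) \<pi> \<and> 2 \<le> length \<pi>)"
    and du_eq: "du (m + 3) = class_count (\<lambda>\<pi>. odd_down \<pi> \<and> inc_over_bound (Suc m) \<pi> \<and> 2 \<le> length \<pi>)"
proof -
  have up: "alternating_up \<pi> = alternating True \<pi>"
    and down: "alternating_down \<pi> = alternating False \<pi>" for \<pi>
    by (auto simp: alternating_up_def alternating_down_def alternating_def)
  have \<sigma>: "avoids \<pi> (pattern_sigma (m + 3)) = inc_over_bound (Suc m) \<pi>" for \<pi>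
    using avoids_pattern_sigma_iff [of \<pi> "Suc m"] by (simp add: numeral_3_eq_3)
  note len = length_finite_permutations_of_set
  show "ud (m + 3) = class_count (\<lambda>\<pi>. odd_up \<pi> \<and> inc_over_bound (Suc m) \<pi> \<and> 2 \<le> length \<pi>)"
    unfolding ud_def class_count_def up_down_def av132_def up \<sigma>
    by (intro ext arg_cong [where f = card]) (auto simp: len)
  show "dd (m + 3) = class_count (\<lambda>\<pi>. even_down \<pi> \<and> inc_over_bound (Suc m) \<pi> \<and> 2 \<le> length \<pi>)"
    unfolding dd_def class_count_def down_down_def av132_def down \<sigma>
    by (intro ext arg_cong [where f = card]) (auto simp: len)
  show "uu (m + 3) = class_count (\<lambda>\<pi>. even_up \<pi> \<and> inc_over_bound (Suc m) \<pi> \<and> 2 \<le> length \<pi>)"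
    unfolding uu_def class_count_def up_up_def av132_def up \<sigma>
    by (intro ext arg_cong [where f = card]) (auto simp: len)
  show "du (m + 3) = class_count (\<lambda>\<pi>. odd_down \<pi> \<and> inc_over_bound (Suc m) \<pi> \<and> 2 \<le> length \<pi>)"
    unfolding du_def class_count_def down_up_def av132_def down \<sigma>
    by (intro ext arg_cong [where f = card]) (auto simp: len)
qed

subsection \<open>Solution in terms of Chebyshev polynomials\<close>

text \<open>At 1/(2x) the factor 2t of the Chebyshev recurrence is 1/x; multiplying by x clears
  it.\<close>

lemma cheb_U_at_rec: "r \<ge> 1 \<Longrightarrow> fls_X * cheb_U_at r = cheb_U_at (r - 1) - fls_X * cheb_U_at (r - 2)"
proof -
  assume "r \<ge> 1"
  then have "poly (cheb_U r) t = 2 * t * poly (cheb_U (r - 1)) t - poly (cheb_U (r - 2)) t"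
    for t :: "real fls"
    by (subst cheb_U.simps) simp
  from this [of "1 / (2 * fls_X)"]
  have "cheb_U_at r = 2 * (1 / (2 * fls_X)) * cheb_U_at (r - 1) - cheb_U_at (r - 2)"
    unfolding cheb_U_at_def .
  moreover have "2 * fls_X * (1 / (2 * fls_X)) = (1 :: real fls)"
    by simp
  ultimately show ?thesis
    by algebra
qed

text \<open>A computation in a field. \<open>V n\<close> stands for U_(n-1) at 1/(2x),
  \<open>a\<close> and \<open>d\<close> for the series A and D, \<open>s\<close> for the
  sigma-avoiding odd-length up series including length 1, and \<open>e\<close> for UU. The
  conclusions are UD, DD, UU and DU for k = m + 3.\<close>

lemma chebyshev_recurrence_solution:
  fixes X :: "'a :: field" and V a d :: "nat \<Rightarrow> 'a"
  assumes X: "X \<noteq> 0" and V: "V 0 = 0" "V 1 = 1" "\<And>n. X * V (n + 2) = V (n + 1) - X * V n"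
    and V_nz: "\<And>n. V (n + 1) \<noteq> 0"
    and a: "a 0 = 0" "\<And>n. a (Suc n) = X * (a n * a (Suc n) + 1)"
    and d: "d 0 = 1" "\<And>n. d (Suc n) = 1 + X * (d n * a (Suc n))"
    and s: "s = X * (a m * s + 1)" and e: "e = X * (a m * e + s)"
  shows "X * (a m * s) = X * V m / V (m + 2)"
    and "X * (d m * s) = (X ^ (m + 1) + V m) / V (m + 2)"
    and "e = (V (m + 1))\<^sup>2 / (V (m + 2))\<^sup>2"
    and "X * (d m * e + X * (d m * s)) = X / (V (m + 2))\<^sup>2 *
      (X ^ m * (V (m + 1) + X * V (m + 2)) + 2 * (V (m + 1))\<^sup>2 + (V m)\<^sup>2 - 2)"
proof -
  \<comment> \<open>The map from c to X/(1 - Xc) advances the ratio of consecutive \<open>V\<close>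
    by one index. It serves both \<open>a\<close> and \<open>s\<close>.\<close>
  have step: "b * V (n + 2) = V (n + 1)" if "c * V (n + 1) = V n" "b = X * (c * b + 1)" for b c n
  proof -
    have "X * (b * V (n + 2)) = b * V (n + 1) - X * b * V n"
      by (simp only: mult.left_commute [of X] V(3)) (simp add: algebra_simps)
    also have "\<dots> = (b - X * (c * b)) * V (n + 1)"
      by (simp only: that(1) [symmetric]) (simp add: algebra_simps)
    also have "b - X * (c * b) = X"
      using that(2) by algebra
    finally show ?thesis
      using X by simp
  qed
  have aV: "a n * V (n + 1) = V n" for n
  proof (induction n)
    case (Suc n)
    then show ?case
      using step [OF Suc a(2)] by simp
  qed (use a V in simp)
  have sV: "s * V (m + 2) = V (m + 1)"
    using step [OF aV s] .
  \<comment> \<open>In the induction step the term \<open>X * V n\<close> cancels against the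
    recurrence for \<open>V\<close>, and one more power of \<open>X\<close> appears.\<close>
  have dV: "X * d n * V (n + 1) = X ^ (n + 1) + V n" for n
  proof (induction n)
    case (Suc n)
    have "X * d (Suc n) * V (n + 2) = X * V (n + 2) + X * (X * d n * (a (Suc n) * V (n + 2)))"
      by (subst d(2)) (simp add: algebra_simps)
    also have "a (Suc n) * V (n + 2) = V (n + 1)"
      using aV [of "Suc n"] by simp
    finally show ?case
      using Suc V(3) [of n] by (simp add: algebra_simps)
  qed (use d V in simp)
  \<comment> \<open>After multiplication by \<open>X\<close>, two instances of the recurrence
    identify consecutive values of the left side.\<close>
  have cassini: "(V (n + 1))\<^sup>2 - V (n + 2) * V n = 1" for n
  proof (induction n)
    case (Suc n)
    have "X * ((V (n + 2))\<^sup>2 - V (n + 3) * V (n + 1)) = X * ((V (n + 1))\<^sup>2 - V (n + 2) * V n)"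
      using V(3) [of n] V(3) [of "n + 1"] by (simp add: numeral_3_eq_3) algebra
    then show ?case
      using X Suc by (simp add: numeral_3_eq_3)
  qed (use V in simp)
  define Y Z W where YZW: "Y = V (m + 1)" "Z = V m" "W = V (m + 2)"
  have nz: "Y \<noteq> 0" "W \<noteq> 0"
    using V_nz [of m] V_nz [of "m + 1"] by (simp_all add: YZW)
  have rec: "X * W = Y - X * Z" and cas: "Y\<^sup>2 - W * Z = 1"
    using V(3) cassini by (simp_all add: YZW)
  have a_m: "a m = Z / Y" and s_eq: "s = Y / W" and d_m: "d m = (X ^ (m + 1) + Z) / (X * Y)"
    using aV [of m] sV dV [of m] nz X by (simp_all add: YZW field_simps)
  \<comment> \<open>Since \<open>a m = Z / Y\<close>, the recurrence gives (1 - X a_m) Y = X W,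
    which solves the linear equation for \<open>e\<close>.\<close>
  have "e * (X * W) = X * s * Y"
  proof -
    have "e * (X * W) = (e - X * (a m * e)) * Y"
      unfolding rec a_m using nz by (simp add: field_simps)
    also have "e - X * (a m * e) = X * s"
      using e by algebra
    finally show ?thesis .
  qed
  then have e_eq: "e = Y\<^sup>2 / W\<^sup>2"
    using nz X s_eq by (simp add: field_simps power2_eq_square)
  show "X * (a m * s) = X * V m / V (m + 2)"
    unfolding YZW [symmetric] a_m s_eq using nz by simp
  show "X * (d m * s) = (X ^ (m + 1) + V m) / V (m + 2)"
    unfolding YZW [symmetric] d_m s_eq using nz X by simp
  show "e = (V (m + 1))\<^sup>2 / (V (m + 2))\<^sup>2"
    unfolding YZW [symmetric] by (rule e_eq)
  have "X * (d m * e + X * (d m * s)) = (X ^ (m + 1) * Y + Z * Y + X * (X ^ (m + 1) + Z) * W) / W\<^sup>2"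
    unfolding d_m e_eq s_eq using nz X by (simp add: field_simps power2_eq_square)
  also have "X ^ (m + 1) * Y + Z * Y + X * (X ^ (m + 1) + Z) * W =
      X * (X ^ m * (Y + X * W) + 2 * Y\<^sup>2 + Z\<^sup>2 - 2)"
  proof -
    \<comment> \<open>With \<open>q\<close> in place of \<open>X ^ m\<close> this is a polynomial
      identity: the terms in \<open>q\<close> agree, and the rest follows from \<open>rec\<close>
      and \<open>cas\<close>.\<close>
    have "q * X * Y + Z * Y + X * (q * X + Z) * W = X * (q * (Y + X * W) + 2 * Y\<^sup>2 + Z\<^sup>2 - 2)" for q
      using rec cas by algebra
    then show ?thesis
      unfolding power_add power_one_right .
  qed
  finally show "X * (d m * e + X * (d m * s)) = X / (V (m + 2))\<^sup>2 *
      (X ^ m * (V (m + 1) + X * V (m + 2)) + 2 * (V (m + 1))\<^sup>2 + (V m)\<^sup>2 - 2)"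
    unfolding YZW [symmetric] by simp
qed

theorem theorem2p6:
  fixes k :: nat
  assumes "k \<ge> 3"
  shows "fps_to_fls (gen_fun (ud k)) =
           fls_X * cheb_U_at (int k - 4) / cheb_U_at (int k - 2) \<and>
         fps_to_fls (gen_fun (dd k)) =
           (fls_X ^ (k - 2) + cheb_U_at (int k - 4)) / cheb_U_at (int k - 2) \<and>
         fps_to_fls (gen_fun (uu k)) =
           (cheb_U_at (int k - 3))\<^sup>2 / (cheb_U_at (int k - 2))\<^sup>2 \<and>
         fps_to_fls (gen_fun (du k)) =
           fls_X / (cheb_U_at (int k - 2))\<^sup>2 *
           (fls_X ^ (k - 3) * (cheb_U_at (int k - 3) + fls_X * cheb_U_at (int k - 2))
            + 2 * (cheb_U_at (int k - 3))\<^sup>2 + (cheb_U_at (int k - 4))\<^sup>2 - 2)"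
proof -
  define m where "m = k - 3"
  have k: "k = m + 3"
    using assms by (simp add: m_def)
  \<comment> \<open>The index shift makes \<open>V 0\<close> the value U_(-1) = 0, which is U_(k-4)
    for k = 3.\<close>
  define V :: "nat \<Rightarrow> real fls" where "V n = cheb_U_at (int n - 1)" for n
  define a where "a n = fps_to_fls (class_gf (\<lambda>\<pi>. odd_up \<pi> \<and> inc_bound n \<pi>))" for n
  define d where "d n = fps_to_fls (class_gf (\<lambda>\<pi>. even_down \<pi> \<and> inc_bound n \<pi>))" for n
  define s where "s = fps_to_fls (class_gf (\<lambda>\<pi>. odd_up \<pi> \<and> inc_over_bound (Suc m) \<pi>))"
  have V: "V 0 = 0" "V 1 = 1"
    by (simp_all add: V_def cheb_U_at_def cheb_U.simps)
  have V_rec: "fls_X * V (n + 2) = V (n + 1) - fls_X * V n" for n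
    using cheb_U_at_rec [of "int n + 1"] by (simp add: V_def add.commute)
  have V_nz: "V (n + 1) \<noteq> 0" for n
    using cheb_U_at_nonzero [of "int n"] by (simp add: V_def)
  have a: "a 0 = 0" "a (Suc n) = fls_X * (a n * a (Suc n) + 1)" for n
    unfolding a_def class_gf_odd_up_inc_bound_0
    by (simp, subst class_gf_odd_up_inc_bound_Suc)
      (simp only: fls_times_fps_to_fls fps_to_fls_plus fps_X_to_fls fps_one_to_fls)
  have d: "d 0 = 1" "d (Suc n) = 1 + fls_X * (d n * a (Suc n))" for n
    unfolding a_def d_def class_gf_even_down_inc_bound_0
    by (simp, subst class_gf_even_down_inc_bound_Suc)
      (simp only: fls_times_fps_to_fls fps_to_fls_plus fps_X_to_fls fps_one_to_fls)
  have s: "s = fls_X * (a m * s + 1)"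
    unfolding a_def s_def
    by (subst class_gf_odd_up_inc_over_bound)
      (simp only: fls_times_fps_to_fls fps_to_fls_plus fps_X_to_fls fps_one_to_fls)
  have ud: "fps_to_fls (gen_fun (ud k)) = fls_X * (a m * s)"
    unfolding k ud_eq a_def s_def class_gf_up_down
    by (simp only: fls_times_fps_to_fls fps_X_to_fls)
  have dd: "fps_to_fls (gen_fun (dd k)) = fls_X * (d m * s)"
    unfolding k dd_eq d_def s_def class_gf_down_down
    by (simp only: fls_times_fps_to_fls fps_X_to_fls)
  \<comment> \<open>UU stays on both sides: this is the linear equation for \<open>e\<close> in the
    field computation.\<close>
  have uu: "fps_to_fls (gen_fun (uu k)) = fls_X * (a m * fps_to_fls (gen_fun (uu k)) + s)"
    unfolding k uu_eq a_def s_def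
    by (subst class_gf_up_up)
      (simp only: fls_times_fps_to_fls fps_to_fls_plus fps_X_to_fls)
  have du: "fps_to_fls (gen_fun (du k)) =
      fls_X * (d m * fps_to_fls (gen_fun (uu k)) + fls_X * (d m * s))"
    unfolding dd [symmetric] unfolding k du_eq uu_eq dd_eq d_def class_gf_down_up
    by (simp only: fls_times_fps_to_fls fps_to_fls_plus fps_X_to_fls)
  have idx: "cheb_U_at (int k - 4) = V m" "cheb_U_at (int k - 3) = V (m + 1)"
    "cheb_U_at (int k - 2) = V (m + 2)" "k - 2 = m + 1" "k - 3 = m"
    by (simp_all add: k V_def)
  note sol = chebyshev_recurrence_solution [where X = fls_X and V = V and a = a and d = d,
      OF fls_X_nonzero V V_rec V_nz a d s uu]
  show ?thesis
    unfolding ud dd du idx using sol by blast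
qed

end
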